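(* Let $K$ be a (not necessarily commutative) field of finite dimension over its centre $k$, and let $\alpha:K\to K$ be a $k$-automorphism of fields (a ring automorphism of $K$ fixing $k$ pointwise). Then there is $a\in K$, $a\ne 0$, such that for all $x\in K$, $\alpha(x)=a^{-1}xa$.
   Context: A field is a division ring, multiplication not assumed commutative. *)

theory Defs
  imports "HOL-Algebra.Embedded_Algebras" "HOL-Algebra.QuotRing"
begin

(* A division ring, multiplication not assumed commutative. As in the library's locale field,
   the condition on units also rules out the zero ring; see one_not_zero below. *)
locale skew_field = ring +
  assumes skew_field_Units: "Units R = carrier R - {\<zero>}"

lemma (in skew_field) one_not_zero: "\<one> \<noteq> \<zero>"
  using Units_one_closed skew_field_Units by auto

definition ring_centre :: "('a, 'b) ring_scheme \<Rightarrow> 'a set" where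
  "ring_centre R = {z \<in> carrier R. \<forall>x \<in> carrier R. z \<otimes>\<^bsub>R\<^esub> x = x \<otimes>\<^bsub>R\<^esub> z}"

(* The library's theory of dimension takes scalars in a subfield, so this lemma makes it
   applicable with scalars in the centre. *)
lemma (in skew_field) ring_centre_subfield: "subfield (ring_centre R) R"
proof -
  let ?Z = "ring_centre R"
  have sub: "subring ?Z R"
  proof (rule subringI)
    fix h assume h: "h \<in> ?Z"
    show "\<ominus> h \<in> ?Z"
      using h unfolding ring_centre_def by (auto simp: l_minus r_minus)
  next
    fix h1 h2 assume h: "h1 \<in> ?Z" "h2 \<in> ?Z"
    show "h1 \<otimes> h2 \<in> ?Z"
    proof -
      have c: "h1 \<in> carrier R" "h2 \<in> carrier R"
        using h by (auto simp: ring_centre_def)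
      have "h1 \<otimes> h2 \<otimes> x = x \<otimes> (h1 \<otimes> h2)" if x: "x \<in> carrier R" for x
      proof -
        have "h1 \<otimes> h2 \<otimes> x = h1 \<otimes> (h2 \<otimes> x)"
          by (rule m_assoc[OF c x])
        also have "h2 \<otimes> x = x \<otimes> h2"
          using h x by (simp add: ring_centre_def)
        also have "h1 \<otimes> (x \<otimes> h2) = h1 \<otimes> x \<otimes> h2"
          by (rule m_assoc[OF c(1) x c(2), symmetric])
        also have "h1 \<otimes> x = x \<otimes> h1"
          using h x by (simp add: ring_centre_def)
        also have "x \<otimes> h1 \<otimes> h2 = x \<otimes> (h1 \<otimes> h2)"
          by (rule m_assoc[OF x c])
        finally show ?thesis .
      qed
      with c show ?thesis by (simp add: ring_centre_def)
    qed
    show "h1 \<oplus> h2 \<in> ?Z"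
      using h unfolding ring_centre_def by (auto simp: l_distr r_distr)
  qed (auto simp: ring_centre_def)
  have subc: "subcring ?Z R"
    by (rule subcringI[OF sub]) (unfold ring_centre_def, blast)
  have inv: "inv z \<in> ?Z" if z: "z \<in> ?Z" "z \<noteq> \<zero>" for z
  proof -
    have zU: "z \<in> Units R"
      using z skew_field_Units by (auto simp: ring_centre_def)
    then have zc: "z \<in> carrier R" "inv z \<in> carrier R"
      by auto
    have "inv z \<otimes> x = x \<otimes> inv z" if x: "x \<in> carrier R" for x
    proof -
      have "inv z \<otimes> x = inv z \<otimes> x \<otimes> (z \<otimes> inv z)"
        using zU zc x by simp
      also have "\<dots> = inv z \<otimes> (x \<otimes> z) \<otimes> inv z"
        by (simp only: m_assoc m_closed zc x)
      also have "x \<otimes> z = z \<otimes> x"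
        using z x by (simp add: ring_centre_def)
      also have "inv z \<otimes> (z \<otimes> x) = x"
        by (simp only: m_assoc[symmetric] zc x Units_l_inv[OF zU] l_one)
      finally show ?thesis .
    qed
    with zc show ?thesis by (simp add: ring_centre_def)
  qed
  show ?thesis
  proof (rule subfieldI[OF subc], intro equalityI subsetI)
    fix z assume z: "z \<in> Units (R\<lparr>carrier := ?Z\<rparr>)"
    then obtain w where w: "z \<in> ?Z" "w \<in> ?Z" "z \<otimes> w = \<one>"
      unfolding Units_def by auto
    moreover have "z \<noteq> \<zero>"
    proof
      assume "z = \<zero>"
      moreover have "w \<in> carrier R"
        using w(2) unfolding ring_centre_def by blast
      ultimately show False
        using w(3) one_not_zero by simp
    qed
    ultimately show "z \<in> ?Z - {\<zero>}" by simp
  next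
    fix z assume z: "z \<in> ?Z - {\<zero>}"
    then have "z \<in> Units R"
      using skew_field_Units by (auto simp: ring_centre_def)
    then have "inv z \<otimes> z = \<one>" "z \<otimes> inv z = \<one>"
      by simp_all
    moreover have "inv z \<in> ?Z"
      using z inv by blast
    ultimately show "z \<in> Units (R\<lparr>carrier := ?Z\<rparr>)"
      using z unfolding Units_def by (simp, blast)
  qed
qed

end

theory Submission
  imports Defs
begin

text \<open>
  Write \<open>Z\<close> for the centre of \<open>K\<close> and let \<open>b\<^sub>0, \<dots>, b\<^sub>n\<^sub>-\<^sub>1\<close> be a basis of \<open>K\<close> over \<open>Z\<close>.
  The \<open>n + 1\<close> maps \<open>f\<^sub>i : x \<mapsto> x b\<^sub>i\<close> for \<open>i < n\<close> and \<open>f\<^sub>n = \<alpha>\<close> are \<open>Z\<close>-linear. Such maps are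
  determined by their values at the basis, so they form a left \<open>K\<close>-vector space of dimension \<open>n\<close>,
  and there are coefficients \<open>a\<^sub>i\<close> in \<open>K\<close>, not all zero, with \<open>\<Sum> a\<^sub>i f\<^sub>i = 0\<close>. This is
  \<open>underdetermined_system_solvable\<close> together with \<open>linear_vanishes_on_Span\<close>.

  Dedekind's argument for the independence of characters then applies
  (\<open>minimal_dependence_intertwines\<close>). Each map satisfies \<open>f\<^sub>i (y x) = \<sigma>\<^sub>i(y) f\<^sub>i(x)\<close>, where
  \<open>\<sigma>\<^sub>i\<close> is the identity for \<open>i < n\<close> and \<open>\<sigma>\<^sub>n = \<alpha>\<close>. A relation of minimal support, normalised to
  \<open>a\<^sub>p = 1\<close>, has \<open>a\<^sub>i \<sigma>\<^sub>i(y) = \<sigma>\<^sub>p(y) a\<^sub>i\<close> for all \<open>i\<close> and \<open>y\<close>. Any nonzero coefficient joining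
  the identity to \<open>\<alpha>\<close> in these equations exhibits \<open>\<alpha>\<close> as an inner automorphism:

  \<^item> If \<open>p = n\<close>, then \<open>a\<^sub>i y = \<alpha>(y) a\<^sub>i\<close> for \<open>i < n\<close>, and some such \<open>a\<^sub>i\<close> is nonzero because
    \<open>\<alpha>\<close> is not the zero map.

  \<^item> If \<open>p < n\<close>, then \<open>a\<^sub>n \<alpha>(y) = y a\<^sub>n\<close> and the other \<open>a\<^sub>i\<close> are central. If \<open>a\<^sub>n\<close> were
    zero, the relation at \<open>x = 1\<close> would be a nontrivial linear dependence of the \<open>b\<^sub>i\<close> over \<open>Z\<close>.
\<close>

section \<open>Combinations and spans\<close>

lemma (in ring) combine_map_upt:
  assumes "\<And>i. i < n \<Longrightarrow> a i \<in> carrier R" "\<And>i. i < n \<Longrightarrow> u i \<in> carrier R"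
  shows "combine (map a [0..<n]) (map u [0..<n]) = (\<Oplus>i\<in>{..<n}. a i \<otimes> u i)"
  using assms
proof (induction n)
  case (Suc n)
  have "combine (map a [0..<Suc n]) (map u [0..<Suc n])
      = combine (map a [0..<n]) (map u [0..<n]) \<oplus> combine [a n] [u n]"
    using Suc.prems by (subst combine_append) auto
  also have "\<dots> = (\<Oplus>i\<in>{..<n}. a i \<otimes> u i) \<oplus> (a n \<otimes> u n)"
    using Suc by simp
  also have "\<dots> = (\<Oplus>i\<in>{..<Suc n}. a i \<otimes> u i)"
    using Suc.prems by (simp add: lessThan_Suc Pi_iff a_comm)
  finally show ?case .
qed simp

lemma (in ring) linear_vanishes_on_Span:
  assumes Z: "subfield Z R" and Us: "set Us \<subseteq> carrier R"
    and g_closed: "\<And>x. x \<in> carrier R \<Longrightarrow> g x \<in> carrier R"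
    and g_add: "\<And>x y. x \<in> carrier R \<Longrightarrow> y \<in> carrier R \<Longrightarrow> g (x \<oplus> y) = g x \<oplus> g y"
    and g_scale: "\<And>c x. c \<in> Z \<Longrightarrow> x \<in> carrier R \<Longrightarrow> g (c \<otimes> x) = c \<otimes> g x"
    and g_Us: "\<And>u. u \<in> set Us \<Longrightarrow> g u = \<zero>"
    and x: "x \<in> Span Z Us"
  shows "g x = \<zero>"
proof -
  have ZR: "Z \<subseteq> carrier R"
    using Z by (rule subfieldE(3))
  have "g \<zero> \<oplus> g \<zero> = g \<zero>"
    using g_add[of \<zero> \<zero>] by simp
  then have g0: "g \<zero> = \<zero>"
    using g_closed[of \<zero>] by (metis add.l_cancel_one' zero_closed)
  have "g (combine Ks Us) = \<zero>" if "set Ks \<subseteq> Z" for Ks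
    using that Us g_Us
  proof (induction Ks Us rule: combine.induct)
    case (1 k Ks u Us)
    have "k \<in> Z" "k \<in> carrier R" "u \<in> carrier R" "combine Ks Us \<in> carrier R"
      using 1 ZR by (auto intro!: combine_in_carrier)
    then show ?case
      using 1 by (simp add: g_add g_scale)
  qed (simp_all add: g0)
  then show ?thesis
    using x unfolding Span_mem_iff_length_version[OF Z Us] by blast
qed

section \<open>Linear dependence over a skew field\<close>

lemma (in skew_field) nonzero_inv:
  assumes "a \<in> carrier R" "a \<noteq> \<zero>"
  shows "inv a \<in> carrier R" "inv a \<otimes> a = \<one>" "a \<otimes> inv a = \<one>" "inv a \<noteq> \<zero>"
proof -
  have "a \<in> Units R"
    using assms skew_field_Units by blast
  then show "inv a \<in> carrier R" "inv a \<otimes> a = \<one>" "a \<otimes> inv a = \<one>"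
    by simp_all
  then show "inv a \<noteq> \<zero>"
    using assms(1) one_not_zero by force
qed

text \<open>
  Gaussian elimination, one equation at a time. The unknowns \<open>v i\<close> multiply from the left, so a pivot
  \<open>A p j\<close> must be cancelled by right multiplication of \<open>A i j\<close> with its inverse.
\<close>

lemma (in skew_field) underdetermined_system_solvable:
  assumes "finite J" "finite I" "card J < card I"
    and "\<And>i j. i \<in> I \<Longrightarrow> j \<in> J \<Longrightarrow> A i j \<in> carrier R"
  shows "\<exists>v. v \<in> I \<rightarrow> carrier R \<and> (\<exists>i\<in>I. v i \<noteq> \<zero>) \<and> (\<forall>j\<in>J. (\<Oplus>i\<in>I. v i \<otimes> A i j) = \<zero>)"
  using assms
proof (induction J arbitrary: I A rule: finite_induct)
  case empty
  then obtain i where "i \<in> I"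
    by fastforce
  then show ?case
    by (intro exI[of _ "\<lambda>_. \<one>"]) (auto simp: one_not_zero)
next
  case (insert j J)
  show ?case
  proof (cases "\<forall>i\<in>I. A i j = \<zero>")
    case True
    obtain v where v: "v \<in> I \<rightarrow> carrier R" "\<exists>i\<in>I. v i \<noteq> \<zero>"
        "\<forall>j\<in>J. (\<Oplus>i\<in>I. v i \<otimes> A i j) = \<zero>"
      using insert.IH[of I A] insert.prems insert.hyps by auto
    have "(\<Oplus>i\<in>I. v i \<otimes> A i j) = \<zero>"
      using True v(1) by (intro add.finprod_one_eqI) (auto simp: Pi_iff)
    then show ?thesis
      using v by blast
  next
    case False
    then obtain p where p: "p \<in> I" "A p j \<noteq> \<zero>"
      by blast
    \<comment> \<open>Solving equation \<open>j\<close> for \<open>v p\<close> leaves the system \<open>B\<close> in the other unknowns.\<close>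
    define I' where "I' = I - {p}"
    define t where "t i = A i j \<otimes> inv (A p j)" for i
    have I': "finite I'" "p \<notin> I'" "I = insert p I'"
      using p insert.prems by (auto simp: I'_def)
    have A: "A i j' \<in> carrier R" if "i \<in> I" "j' \<in> insert j J" for i j'
      using insert.prems that by blast
    have inv: "inv (A p j) \<in> carrier R" "inv (A p j) \<otimes> A p j = \<one>"
      using nonzero_inv[of "A p j"] A p by auto
    have t: "t i \<in> carrier R" if "i \<in> I" for i
      using A that inv by (simp add: t_def)
    define B where "B i j' = A i j' \<ominus> t i \<otimes> A p j'" for i j'
    have B: "B i j' \<in> carrier R" if "i \<in> I" "j' \<in> insert j J" for i j'
      using A t that p by (simp add: B_def)
    have "card J < card I'"
      using insert.hyps insert.prems p by (simp add: I'_def)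
    then obtain w where w: "w \<in> I' \<rightarrow> carrier R" "\<exists>i\<in>I'. w i \<noteq> \<zero>"
        "\<forall>j'\<in>J. (\<Oplus>i\<in>I'. w i \<otimes> B i j') = \<zero>"
      using insert.IH[of I' B] I' B by auto
    define s where "s = (\<Oplus>i\<in>I'. w i \<otimes> t i)"
    have wi: "w i \<in> carrier R" if "i \<in> I'" for i
      using w(1) that by blast
    have s: "s \<in> carrier R"
      unfolding s_def using wi t I' by (intro finsum_closed) auto
    define v where "v = w(p := \<ominus> s)"
    have "(\<Oplus>i\<in>I'. w i \<otimes> B i j) = \<zero>"
    proof (rule add.finprod_one_eqI)
      fix i assume i: "i \<in> I'"
      have "t i \<otimes> A p j = A i j"
        using i I' A inv p by (simp add: t_def m_assoc)
      then show "w i \<otimes> B i j = \<zero>"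
        using i I' A[of i j] wi[of i] by (simp add: B_def r_minus r_neg a_minus_def)
    qed
    then have wB: "(\<Oplus>i\<in>I'. w i \<otimes> B i j') = \<zero>" if "j' \<in> insert j J" for j'
      using that w(3) by auto
    have "(\<Oplus>i\<in>I. v i \<otimes> A i j') = \<zero>" if j': "j' \<in> insert j J" for j'
    proof -
      have Ap: "A p j' \<in> carrier R"
        using A p j' by blast
      have "(\<Oplus>i\<in>I'. w i \<otimes> A i j') = (\<Oplus>i\<in>I'. w i \<otimes> B i j' \<oplus> (w i \<otimes> t i) \<otimes> A p j')"
      proof (rule finsum_cong'[OF refl])
        fix i assume i: "i \<in> I'"
        then have c: "w i \<in> carrier R" "t i \<in> carrier R" "A i j' \<in> carrier R" "B i j' \<in> carrier R"
          using wi t A B j' I' by auto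
        have "A i j' = B i j' \<oplus> t i \<otimes> A p j'"
          using c Ap by (simp add: B_def a_minus_def a_assoc l_neg)
        then show "w i \<otimes> A i j' = w i \<otimes> B i j' \<oplus> (w i \<otimes> t i) \<otimes> A p j'"
          using c Ap by (simp add: r_distr m_assoc)
      qed (use wi t A B I' j' Ap in auto)
      also have "\<dots> = (\<Oplus>i\<in>I'. w i \<otimes> B i j') \<oplus> (\<Oplus>i\<in>I'. (w i \<otimes> t i) \<otimes> A p j')"
        using wi t B I' j' Ap by (intro finsum_addf) auto
      also have "(\<Oplus>i\<in>I'. (w i \<otimes> t i) \<otimes> A p j') = s \<otimes> A p j'"
        unfolding s_def using wi t I' Ap by (intro finsum_ldistr[symmetric]) auto
      finally have eq: "(\<Oplus>i\<in>I'. w i \<otimes> A i j') = s \<otimes> A p j'"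
        using wB[OF j'] s Ap by simp
      have "(\<Oplus>i\<in>I. v i \<otimes> A i j') = v p \<otimes> A p j' \<oplus> (\<Oplus>i\<in>I'. v i \<otimes> A i j')"
        unfolding I'(3) using I' wi s A j' by (intro finsum_insert) (auto simp: v_def)
      also have "(\<Oplus>i\<in>I'. v i \<otimes> A i j') = (\<Oplus>i\<in>I'. w i \<otimes> A i j')"
        using I' wi A j' by (intro finsum_cong'[OF refl]) (auto simp: v_def)
      finally show ?thesis
        using eq s Ap by (simp add: v_def l_minus l_neg)
    qed
    moreover have "v \<in> I \<rightarrow> carrier R"
      using I' wi s by (auto simp: v_def)
    moreover have "\<exists>i\<in>I. v i \<noteq> \<zero>"
      using I' w(2) unfolding v_def by (metis fun_upd_other insertCI)
    ultimately show ?thesis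
      by blast
  qed
qed

text \<open>
  Dedekind's argument. Replacing \<open>x\<close> by \<open>y x\<close> in a relation \<open>\<Sum> a\<^sub>i f\<^sub>i = 0\<close>, and multiplying the relation
  by \<open>\<sigma>\<^sub>p(y)\<close> from the left, gives two relations whose difference has the coefficients
  \<open>a\<^sub>i \<sigma>\<^sub>i(y) - \<sigma>\<^sub>p(y) a\<^sub>i\<close>. If \<open>a\<^sub>p = 1\<close>, the coefficient at \<open>p\<close> cancels, so minimality of the
  support makes all of them vanish.
\<close>

lemma (in skew_field) minimal_dependence_intertwines:
  assumes fin: "finite I"
    and f: "\<And>i x. i \<in> I \<Longrightarrow> x \<in> carrier R \<Longrightarrow> f i x \<in> carrier R"
    and \<sigma>: "\<And>i y. i \<in> I \<Longrightarrow> y \<in> carrier R \<Longrightarrow> \<sigma> i y \<in> carrier R"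
    and f_mult: "\<And>i x y. i \<in> I \<Longrightarrow> x \<in> carrier R \<Longrightarrow> y \<in> carrier R \<Longrightarrow>
                   f i (y \<otimes> x) = \<sigma> i y \<otimes> f i x"
    and dep: "v \<in> I \<rightarrow> carrier R" "\<exists>i\<in>I. v i \<noteq> \<zero>"
      "\<And>x. x \<in> carrier R \<Longrightarrow> (\<Oplus>i\<in>I. v i \<otimes> f i x) = \<zero>"
  obtains a p where "a \<in> I \<rightarrow> carrier R" "p \<in> I" "a p = \<one>"
    "\<And>x. x \<in> carrier R \<Longrightarrow> (\<Oplus>i\<in>I. a i \<otimes> f i x) = \<zero>"
    "\<And>i y. i \<in> I \<Longrightarrow> y \<in> carrier R \<Longrightarrow> a i \<otimes> \<sigma> i y = \<sigma> p y \<otimes> a i"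
proof -
  define supp where "supp a = {i\<in>I. a i \<noteq> \<zero>}" for a :: "'c \<Rightarrow> 'a"
  define rel where "rel a \<longleftrightarrow> a \<in> I \<rightarrow> carrier R \<and> supp a \<noteq> {} \<and>
      (\<forall>x\<in>carrier R. (\<Oplus>i\<in>I. a i \<otimes> f i x) = \<zero>)" for a
  have "rel v"
    using dep by (auto simp: rel_def supp_def)
  then obtain m where m: "rel m" "\<And>b. rel b \<Longrightarrow> card (supp m) \<le> card (supp b)"
    using ex_has_least_nat[of rel v "\<lambda>a. card (supp a)"] by blast
  obtain p where p: "p \<in> I" "m p \<noteq> \<zero>"
    using m(1) by (auto simp: rel_def supp_def)
  have mc: "m i \<in> carrier R" if "i \<in> I" for i
    using m(1) that by (auto simp: rel_def)
  note mp = nonzero_inv[OF mc[OF p(1)] p(2)]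
  define a where "a i = inv (m p) \<otimes> m i" for i
  have ac: "a i \<in> carrier R" if "i \<in> I" for i
    using mc mp that by (simp add: a_def)
  have ap: "a p = \<one>"
    using mp by (simp add: a_def)
  have supp_a: "supp a \<subseteq> supp m"
    using mp by (auto simp: supp_def a_def)
  have a_rel: "(\<Oplus>i\<in>I. a i \<otimes> f i x) = \<zero>" if x: "x \<in> carrier R" for x
  proof -
    have "(\<Oplus>i\<in>I. a i \<otimes> f i x) = (\<Oplus>i\<in>I. inv (m p) \<otimes> (m i \<otimes> f i x))"
      using mc mp f x by (intro finsum_cong'[OF refl]) (auto simp: a_def m_assoc)
    also have "\<dots> = inv (m p) \<otimes> (\<Oplus>i\<in>I. m i \<otimes> f i x)"
      using mc mp f x fin by (intro finsum_rdistr[symmetric]) auto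
    also have "\<dots> = \<zero>"
      using m(1) mp x by (simp add: rel_def)
    finally show ?thesis .
  qed
  have "a i \<otimes> \<sigma> i y = \<sigma> p y \<otimes> a i" if i: "i \<in> I" and y: "y \<in> carrier R" for i y
  proof -
    define b where "b i = a i \<otimes> \<sigma> i y \<ominus> \<sigma> p y \<otimes> a i" for i
    have bc: "b i \<in> carrier R" if "i \<in> I" for i
      using ac \<sigma> p y that by (simp add: b_def)
    have b_rel: "(\<Oplus>i\<in>I. b i \<otimes> f i x) = \<zero>" if x: "x \<in> carrier R" for x
    proof -
      have "(\<Oplus>i\<in>I. a i \<otimes> f i (y \<otimes> x)) = (\<Oplus>i\<in>I. b i \<otimes> f i x \<oplus> \<sigma> p y \<otimes> (a i \<otimes> f i x))"
      proof (rule finsum_cong'[OF refl])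
        fix i assume i: "i \<in> I"
        then have c: "a i \<in> carrier R" "b i \<in> carrier R" "\<sigma> i y \<in> carrier R" "\<sigma> p y \<in> carrier R"
            "f i x \<in> carrier R"
          using ac bc \<sigma> p x y f by auto
        have "a i \<otimes> \<sigma> i y = b i \<oplus> \<sigma> p y \<otimes> a i"
          using c by (simp add: b_def a_minus_def a_assoc l_neg)
        then have "a i \<otimes> \<sigma> i y \<otimes> f i x = b i \<otimes> f i x \<oplus> \<sigma> p y \<otimes> (a i \<otimes> f i x)"
          using c by (simp add: l_distr m_assoc)
        then show "a i \<otimes> f i (y \<otimes> x) = b i \<otimes> f i x \<oplus> \<sigma> p y \<otimes> (a i \<otimes> f i x)"
          using c i x y by (simp add: f_mult m_assoc)
      qed (use ac bc \<sigma> p x y f in auto)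
      also have "\<dots> = (\<Oplus>i\<in>I. b i \<otimes> f i x) \<oplus> (\<Oplus>i\<in>I. \<sigma> p y \<otimes> (a i \<otimes> f i x))"
        using ac bc \<sigma> p x y f by (intro finsum_addf) auto
      also have "(\<Oplus>i\<in>I. \<sigma> p y \<otimes> (a i \<otimes> f i x)) = \<sigma> p y \<otimes> (\<Oplus>i\<in>I. a i \<otimes> f i x)"
        using ac \<sigma> p x y f fin by (intro finsum_rdistr[symmetric]) auto
      finally have "(\<Oplus>i\<in>I. a i \<otimes> f i (y \<otimes> x)) = (\<Oplus>i\<in>I. b i \<otimes> f i x) \<oplus> \<sigma> p y \<otimes> (\<Oplus>i\<in>I. a i \<otimes> f i x)" .
      moreover have "(\<Oplus>i\<in>I. b i \<otimes> f i x) \<in> carrier R"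
        using bc x f by (intro finsum_closed) auto
      ultimately show ?thesis
        using a_rel x y \<sigma> p by simp
    qed
    have "b p = \<zero>"
      using ap \<sigma> p y by (simp add: b_def r_neg a_minus_def)
    moreover have "supp b \<subseteq> supp a"
      using \<sigma> y p by (auto simp: supp_def b_def a_minus_def)
    ultimately have "supp b \<subset> supp m"
      using supp_a p by (auto simp: supp_def)
    then have "card (supp b) < card (supp m)"
      using fin by (intro psubset_card_mono) (auto simp: supp_def)
    then have "\<not> rel b"
      using m(2)[of b] by linarith
    then have "b i = \<zero>"
      using bc b_rel i by (auto simp: rel_def supp_def)
    then show ?thesis
      using ac \<sigma> p y i by (simp add: b_def)
  qed
  then show ?thesis
    using that[of a p] ac p ap a_rel by blast
qed

section \<open>Automorphisms over the centre are inner\<close>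

theorem mainTheorem6:
  fixes K (structure) and \<alpha> :: "'a \<Rightarrow> 'a"
  assumes "skew_field K"
    and "ring.finite_dimension K (ring_centre K) (carrier K)"
    and "\<alpha> \<in> ring_iso K K"
    and "\<And>c. c \<in> ring_centre K \<Longrightarrow> \<alpha> c = c"
  shows "\<exists>a \<in> carrier K. a \<noteq> \<zero> \<and> (\<forall>x \<in> carrier K. \<alpha> x = inv a \<otimes> x \<otimes> a)"
proof -
  interpret skew_field K by fact
  let ?Z = "ring_centre K"
  note Z = ring_centre_subfield
  have ZK: "?Z \<subseteq> carrier K"
    using Z by (rule subfieldE(3))
  have \<alpha>h: "\<alpha> \<in> ring_hom K K"
    using assms(3) by (simp add: ring_iso_def)
  note \<alpha> = ring_hom_closed[OF \<alpha>h] ring_hom_mult[OF \<alpha>h] ring_hom_add[OF \<alpha>h] ring_hom_one[OF \<alpha>h]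
  obtain n where "dimension n ?Z (carrier K)"
    using assms(2) by blast
  then obtain Vs where Vs: "set Vs \<subseteq> carrier K" "independent ?Z Vs" "length Vs = n"
      "Span ?Z Vs = carrier K"
    using exists_base[OF Z] by blast
  define f where "f i x = (if i = n then \<alpha> x else x \<otimes> Vs ! i)" for i x
  define \<sigma> where "\<sigma> i = (if i = n then \<alpha> else (\<lambda>y. y))" for i
  have V: "Vs ! i \<in> carrier K" if "i < n" for i
    using Vs that by auto
  have fc: "f i x \<in> carrier K" if "i \<in> {..n}" "x \<in> carrier K" for i x
    using that V \<alpha> by (auto simp: f_def)
  have \<sigma>c: "\<sigma> i x \<in> carrier K" if "i \<in> {..n}" "x \<in> carrier K" for i x
    using that \<alpha> by (auto simp: \<sigma>_def)
  have f_mult: "f i (y \<otimes> x) = \<sigma> i y \<otimes> f i x"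
    if "i \<in> {..n}" "x \<in> carrier K" "y \<in> carrier K" for i x y
    using that V \<alpha> by (auto simp: f_def \<sigma>_def m_assoc)
  have f_add: "f i (x \<oplus> y) = f i x \<oplus> f i y"
    if "i \<in> {..n}" "x \<in> carrier K" "y \<in> carrier K" for i x y
    using that V \<alpha> by (auto simp: f_def l_distr)
  have \<sigma>Z: "\<sigma> i c = c" if "c \<in> ?Z" for i c
    using that assms(4) by (simp add: \<sigma>_def)

  \<comment> \<open>One equation for each basis vector, one unknown for each of the \<open>n + 1\<close> maps.\<close>
  have "\<exists>v. v \<in> {..n} \<rightarrow> carrier K \<and> (\<exists>i\<in>{..n}. v i \<noteq> \<zero>)
          \<and> (\<forall>j\<in>{..<n}. (\<Oplus>i\<in>{..n}. v i \<otimes> f i (Vs ! j)) = \<zero>)"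
    using fc V by (intro underdetermined_system_solvable) auto
  then obtain v where v: "v \<in> {..n} \<rightarrow> carrier K" "\<exists>i\<in>{..n}. v i \<noteq> \<zero>"
      and v_basis: "\<And>j. j < n \<Longrightarrow> (\<Oplus>i\<in>{..n}. v i \<otimes> f i (Vs ! j)) = \<zero>"
    by blast
  have vc: "v i \<in> carrier K" if "i \<in> {..n}" for i
    using v(1) that by blast
  define g where "g x = (\<Oplus>i\<in>{..n}. v i \<otimes> f i x)" for x
  have "g x = \<zero>" if "x \<in> carrier K" for x
  proof (rule linear_vanishes_on_Span[where g = g, OF Z Vs(1)])
    show "g x \<in> carrier K" if "x \<in> carrier K" for x
      unfolding g_def using vc fc that by (intro finsum_closed) auto
    show "g (x \<oplus> y) = g x \<oplus> g y" if "x \<in> carrier K" "y \<in> carrier K" for x y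
    proof -
      have "g (x \<oplus> y) = (\<Oplus>i\<in>{..n}. v i \<otimes> f i x \<oplus> v i \<otimes> f i y)"
        unfolding g_def using vc fc that
        by (intro finsum_cong'[OF refl]) (auto simp: f_add r_distr)
      also have "\<dots> = g x \<oplus> g y"
        unfolding g_def using vc fc that by (intro finsum_addf) auto
      finally show ?thesis .
    qed
    show "g (c \<otimes> x) = c \<otimes> g x" if c: "c \<in> ?Z" and x: "x \<in> carrier K" for c x
    proof -
      have cK: "c \<in> carrier K"
        using c ZK by blast
      have "g (c \<otimes> x) = (\<Oplus>i\<in>{..n}. c \<otimes> (v i \<otimes> f i x))"
        unfolding g_def
      proof (rule finsum_cong'[OF refl])
        fix i assume i: "i \<in> {..n}"
        have "v i \<otimes> c = c \<otimes> v i"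
          using c vc[OF i] by (simp add: ring_centre_def)
        then show "v i \<otimes> f i (c \<otimes> x) = c \<otimes> (v i \<otimes> f i x)"
          using i x cK vc fc by (simp add: f_mult \<sigma>Z[OF c] flip: m_assoc)
      qed (use vc fc cK x in auto)
      also have "\<dots> = c \<otimes> g x"
        unfolding g_def using vc fc cK x by (intro finsum_rdistr[symmetric]) auto
      finally show ?thesis .
    qed
    show "g u = \<zero>" if "u \<in> set Vs" for u
      using that Vs(3) v_basis by (auto simp: g_def in_set_conv_nth)
  qed (use that Vs in auto)
  then have dep: "\<And>x. x \<in> carrier K \<Longrightarrow> (\<Oplus>i\<in>{..n}. v i \<otimes> f i x) = \<zero>"
    by (simp add: g_def)
  obtain a p where a: "a \<in> {..n} \<rightarrow> carrier K" "p \<in> {..n}" "a p = \<one>"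
    and a_rel: "\<And>x. x \<in> carrier K \<Longrightarrow> (\<Oplus>i\<in>{..n}. a i \<otimes> f i x) = \<zero>"
    and intertwine: "\<And>i y. i \<in> {..n} \<Longrightarrow> y \<in> carrier K \<Longrightarrow> a i \<otimes> \<sigma> i y = \<sigma> p y \<otimes> a i"
    by (rule minimal_dependence_intertwines[where I = "{..n}" and f = f and \<sigma> = \<sigma> and v = v])
      (assumption | rule finite_atMost fc \<sigma>c f_mult v dep that)+
  have ac: "a i \<in> carrier K" if "i \<le> n" for i
    using a(1) that by blast
  have "(\<Oplus>i\<in>{..n}. a i \<otimes> f i \<one>) = a n \<otimes> f n \<one> \<oplus> (\<Oplus>i\<in>{..<n}. a i \<otimes> f i \<one>)"
    using ac fc by (intro add.finprod_Suc3) auto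
  also have "(\<Oplus>i\<in>{..<n}. a i \<otimes> f i \<one>) = (\<Oplus>i\<in>{..<n}. a i \<otimes> Vs ! i)"
    using ac V by (intro finsum_cong'[OF refl]) (auto simp: f_def)
  finally have at_one: "a n \<oplus> (\<Oplus>i\<in>{..<n}. a i \<otimes> Vs ! i) = \<zero>"
    using a_rel[of \<one>] ac[of n] by (simp add: f_def \<alpha>)
  show ?thesis
  proof (cases "p = n")
    case True
    have "\<exists>i<n. a i \<noteq> \<zero>"
    proof (rule ccontr)
      assume "\<not> (\<exists>i<n. a i \<noteq> \<zero>)"
      then have "(\<Oplus>i\<in>{..<n}. a i \<otimes> Vs ! i) = \<zero>"
        using V by (intro add.finprod_one_eqI) auto
      then show False
        using at_one a(3) True one_not_zero by simp
    qed
    then obtain i where i: "i < n" "a i \<noteq> \<zero>"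
      by blast
    have c: "a i \<in> carrier K"
      using ac i by simp
    note ai = nonzero_inv[OF c i(2)]
    have "\<alpha> x = a i \<otimes> x \<otimes> inv (a i)" if x: "x \<in> carrier K" for x
    proof -
      have "a i \<otimes> x = \<alpha> x \<otimes> a i"
        using intertwine[of i x] i x True by (simp add: \<sigma>_def)
      then show ?thesis
        using ai c x \<alpha>(1)[OF x] by (simp add: m_assoc)
    qed
    moreover have "inv (inv (a i)) = a i"
      using c i(2) skew_field_Units by (intro Units_inv_inv) simp
    ultimately show ?thesis
      using ai by (intro bexI[of _ "inv (a i)"]) auto
  next
    case False
    then have p: "p < n"
      using a(2) by simp
    have central: "a i \<in> ?Z" if "i < n" for i
      using intertwine[of i] ac[of i] that p by (auto simp: ring_centre_def \<sigma>_def)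
    have an: "a n \<noteq> \<zero>"
    proof
      assume "a n = \<zero>"
      then have "(\<Oplus>i\<in>{..<n}. a i \<otimes> Vs ! i) = \<zero>"
        using at_one ac V by simp
      then have "combine (map a [0..<n]) Vs = \<zero>"
        using combine_map_upt[of n a "\<lambda>i. Vs ! i"] ac V Vs(3) by (metis less_imp_le map_nth)
      moreover have "set (map a [0..<n]) \<subseteq> ?Z"
        using central by auto
      ultimately have "set (map a [0..<n]) \<subseteq> {\<zero>}"
        using independent_imp_trivial_combine[OF Z Vs(2)] Vs(3) by fastforce
      then have "a p = \<zero>"
        using p by (force simp: image_subset_iff)
      then show False
        using a(3) one_not_zero by simp
    qed
    have c: "a n \<in> carrier K"
      using ac by simp
    have "\<alpha> x = inv (a n) \<otimes> x \<otimes> a n" if x: "x \<in> carrier K" for x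
    proof -
      have "a n \<otimes> \<alpha> x = x \<otimes> a n"
        using intertwine[of n x] p x by (simp add: \<sigma>_def)
      then show ?thesis
        using nonzero_inv[OF c an] c x \<alpha>(1)[OF x] by (metis m_assoc l_one)
    qed
    then show ?thesis
      using c an by blast
  qed
qed

end
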